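(* Let $p\geq 2$ and $r\geq 2$ be fixed integers. Then for all sufficiently large integers $q$ (that is, for all $q\geq q_0$ for some $q_0=q_0(p,r)$), $$r\bigl(K_{p+1},B_{q}^{(r)}\bigr)=p(q+r-1)+1 .$$
   Context: All graphs are finite and simple. $B_q^{(r)}=K_r+qK_1$ denotes the generalized book: the graph on $q+r$ vertices consisting of an $r$-clique together with $q$ pairwise non-adjacent additional vertices, each adjacent to every vertex of the $r$-clique (equivalently, $q$ distinct $(r+1)$-cliques sharing a common $r$-clique). The Ramsey number $r(H_1,H_2)$ is the least number $n$ such that for every graph $G$ of order $n$, either $H_1\subset G$ or $H_2\subset\overline{G}$, where $\overline{G}$ is the complement of $G$ and $\subset$ means containment as a (not necessarily induced) subgraph. *)

theory Defs
  imports "Graph_Theory.Graph_Theory"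
begin

text \<open>
  A finite simple graph is a \<^locale>\<open>pair_graph\<close>: a finite, symmetric, loop-free digraph
  without parallel arcs. An undirected edge $uv$ is the pair of arcs \<open>(u, v)\<close>, \<open>(v, u)\<close>.
\<close>

definition complement_graph :: "'a pair_pre_digraph \<Rightarrow> 'a pair_pre_digraph" where
  "complement_graph G =
    \<lparr> pverts = pverts G,
      parcs = {(u, v). u \<in> pverts G \<and> v \<in> pverts G \<and> u \<noteq> v \<and> (u, v) \<notin> parcs G} \<rparr>"

definition contains_copy :: "'a pair_pre_digraph \<Rightarrow> 'b pair_pre_digraph \<Rightarrow> bool" where
  "contains_copy G H \<longleftrightarrow>
    (\<exists>H'. subgraph (with_proj H') (with_proj G) \<and> digraph_iso (with_proj H) (with_proj H'))"

definition complete_graph :: "nat \<Rightarrow> nat pair_pre_digraph" where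
  "complete_graph n =
    \<lparr> pverts = {..<n}, parcs = {(u, v). u < n \<and> v < n \<and> u \<noteq> v} \<rparr>"

text \<open>
  The book $B_q^{(r)} = K_r + q K_1$: the vertices below \<open>r\<close> form the clique, the remaining \<open>q\<close>
  vertices are the independent ones.
\<close>

definition book_graph :: "nat \<Rightarrow> nat \<Rightarrow> nat pair_pre_digraph" where
  "book_graph r q =
    \<lparr> pverts = {..<r + q},
      parcs = {(u, v). u < r + q \<and> v < r + q \<and> u \<noteq> v \<and> (u < r \<or> v < r)} \<rparr>"

text \<open>
  Every finite graph is isomorphic to one with vertices in \<^typ>\<open>nat\<close>, so quantifying over those
  covers all graphs of order \<open>n\<close>. The least element exists by Ramsey's theorem, for all finite
  simple \<open>H\<^sub>1\<close> and \<open>H\<^sub>2\<close>.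
\<close>

definition ramsey_number :: "'a pair_pre_digraph \<Rightarrow> 'b pair_pre_digraph \<Rightarrow> nat" where
  "ramsey_number H\<^sub>1 H\<^sub>2 =
    (LEAST n. \<forall>G :: nat pair_pre_digraph. pair_graph G \<and> card (pverts G) = n \<longrightarrow>
      contains_copy G H\<^sub>1 \<or> contains_copy (complement_graph G) H\<^sub>2)"

lemma pair_graph_complement:
  assumes "pair_graph G"
  shows "pair_graph (complement_graph G)"
proof -
  interpret pair_graph G by fact
  have "finite (parcs (complement_graph G))"
    by (rule finite_subset[of _ "pverts G \<times> pverts G"])
      (auto simp: complement_graph_def pair_finite_verts)
  moreover have "sym (parcs G)"
    using pair_sym_arcs by (simp add: symmetric_def)
  ultimately show ?thesis
    by unfold_locales
      (auto simp: complement_graph_def symmetric_def pair_finite_verts intro!: symI dest: symD)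
qed

lemma complete_digraph_complete_graph: "complete_digraph n (with_proj (complete_graph n))"
  by (auto simp: complete_digraph_pair_def complete_graph_def)

lemma pair_graph_book: "pair_graph (book_graph r q)"
proof -
  have "finite (parcs (book_graph r q))"
    by (rule finite_subset[of _ "{..<r + q} \<times> {..<r + q}"]) (auto simp: book_graph_def)
  then show ?thesis
    by unfold_locales (auto simp: book_graph_def symmetric_def intro!: symI)
qed

lemma contains_copy_iff:
  assumes "pair_wf_digraph G" "pair_wf_digraph H"
  shows "contains_copy G H \<longleftrightarrow>
    (\<exists>f. inj_on f (pverts H) \<and> f ` pverts H \<subseteq> pverts G \<and>
      (\<forall>u v. (u, v) \<in> parcs H \<longrightarrow> (f u, f v) \<in> parcs G))" (is "?L \<longleftrightarrow> ?R")
proof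
  assume ?L
  then obtain H' i where sub: "subgraph (with_proj H') (with_proj G)"
    and iso: "pre_digraph.digraph_isomorphism (with_proj H) i"
    and H': "with_proj H' = app_iso i (with_proj H)"
    by (auto simp: contains_copy_def digraph_iso_def)
  have V: "pverts H' = iso_verts i ` pverts H" and A: "parcs H' = iso_arcs i ` parcs H"
    and t: "iso_tail i = fst" and h: "iso_head i = snd"
    using arg_cong[OF H', of verts] arg_cong[OF H', of arcs]
      arg_cong[OF H', of tail] arg_cong[OF H', of head] by simp_all
  have "(iso_verts i u, iso_verts i v) = iso_arcs i (u, v)" if "(u, v) \<in> parcs H" for u v
    using iso that t h by (auto simp: pre_digraph.digraph_isomorphism_def prod_eq_iff)
  then have "(iso_verts i u, iso_verts i v) \<in> parcs G" if "(u, v) \<in> parcs H" for u v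
    using that A sub by (auto simp: subgraph_def)
  moreover have "inj_on (iso_verts i) (pverts H)"
    using iso by (auto simp: pre_digraph.digraph_isomorphism_def)
  ultimately show ?R using V sub by (auto simp: subgraph_def)
next
  assume ?R
  then obtain f where f: "inj_on f (pverts H)" "f ` pverts H \<subseteq> pverts G"
    "\<And>u v. (u, v) \<in> parcs H \<Longrightarrow> (f u, f v) \<in> parcs G" by blast
  interpret G: pair_wf_digraph G by fact
  interpret H: pair_wf_digraph H by fact
  define H' where "H' = \<lparr> pverts = f ` pverts H, parcs = map_prod f f ` parcs H \<rparr>"
  have H'wf: "pair_wf_digraph H'"
    by unfold_locales (auto simp: H'_def dest: H.in_arcsD1 H.in_arcsD2)
  then interpret H': pair_wf_digraph H' .
  have "subgraph (with_proj H') (with_proj G)"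
    using f(2,3) H'.wf_digraph G.wf_digraph
    by (auto simp: subgraph_def compatible_def H'_def)
  moreover
  define i where "i = \<lparr> iso_verts = f, iso_arcs = map_prod f f,
    iso_head = snd, iso_tail = fst \<rparr>"
  have "inj_on (map_prod f f) (parcs H)"
    by (rule inj_on_subset[OF map_prod_inj_on[OF f(1) f(1)]])
      (auto dest: H.in_arcsD1 H.in_arcsD2)
  then have "pre_digraph.digraph_isomorphism (with_proj H) i"
    using f(1) H.wf_digraph by (auto simp: pre_digraph.digraph_isomorphism_def i_def)
  moreover have "with_proj H' = app_iso i (with_proj H)"
    by (simp add: with_proj_def app_iso_def i_def H'_def)
  ultimately show ?L
    unfolding contains_copy_def digraph_iso_def by blast
qed

end

theory Submission
  imports Defs "HOL-Library.Ramsey" "HOL-Library.Disjoint_Sets"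
begin

text \<open>
  The lower bound comes from the complete \<open>p\<close>-partite graph with parts of size at most
  \<open>d = q + r - 1\<close>: it has no \<open>(p + 1)\<close>-clique, and its complement is a disjoint union of
  cliques that are too small to hold the connected graph \<open>B\<^sub>q\<^sup>(\<^sup>r\<^sup>)\<close> on \<open>d + 1\<close> vertices.

  For the upper bound, suppose that a graph on \<open>V\<close> has no \<open>(p + 1)\<close>-clique and that its complement
  has no book. Then every independent \<open>r\<close>-set has at most \<open>d\<close> common non-neighbours, its own vertices
  among them. If there are independent \<open>r\<close>-sets \<open>A\<^sub>0, \<dots>, A\<^sub>p\<^sub>-\<^sub>1\<close> with all edges between
  different ones, then every vertex is a common non-neighbour of some \<open>A\<^sub>i\<close>: otherwise the vertex and
  one of its neighbours in each \<open>A\<^sub>i\<close> form a \<open>(p + 1)\<close>-clique (\<open>misses_a_part\<close>). So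
  \<open>card V \<le> p * d\<close>, with no error term.

  It remains to find such a configuration when \<open>card V > p * d\<close> and \<open>d\<close> is large
  (\<open>complete_multipartite_exists\<close>). The parts are built one at a time, and for that they are
  kept much larger than \<open>r\<close>; by Ramsey's theorem any large enough set contains an independent set of a
  prescribed size. Given \<open>s < p\<close> large independent parts, a vertex with fewer than \<open>t\<close> neighbours in
  a part misses a random \<open>r\<close>-subset of that part with probability close to 1, so there are hardly more than \<open>d\<close> such
  vertices for each part (\<open>card_few_neighbours_le\<close>). As \<open>s \<le> p - 1\<close>, at least \<open>d / 2\<close> vertices
  have \<open>t\<close> neighbours in every part. The number of possible neighbourhoods in the parts does not
  depend on \<open>d\<close>, so \<open>t\<close> of these vertices have the same one; they form the new part, and the old
  parts shrink to \<open>t\<close> common neighbours each (\<open>add_part\<close>).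
\<close>

section \<open>Few vertices have few neighbours in a large independent set\<close>

text \<open>An independent \<open>S \<subseteq> V\<close> is contained in the set below if there are no loops.\<close>

definition common_nonneighbours :: "'a set set \<Rightarrow> 'a set \<Rightarrow> 'a set \<Rightarrow> 'a set" where
  "common_nonneighbours E V S = {v \<in> V. \<forall>x\<in>S. {v, x} \<notin> E}"

text \<open>
  A book in the complement consists of an independent \<open>r\<close>-set and further common non-neighbours of
  it. The bound \<open>d\<close> counts the \<open>r\<close>-set too, so excluding \<open>q\<close> pages means \<open>d = q + r - 1\<close>.
\<close>

definition clique_book_free :: "nat \<Rightarrow> nat \<Rightarrow> nat \<Rightarrow> 'a set \<Rightarrow> 'a set set \<Rightarrow> bool" where
  "clique_book_free p r d V E \<longleftrightarrow> finite V \<and> (\<forall>v. {v} \<notin> E) \<and>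
    (\<forall>K\<subseteq>V. clique K E \<longrightarrow> card K \<le> p) \<and>
    (\<forall>S\<subseteq>V. indep S E \<and> card S = r \<longrightarrow> card (common_nonneighbours E V S) \<le> d)"

definition complete_between :: "'a set set \<Rightarrow> nat \<Rightarrow> (nat \<Rightarrow> 'a set) \<Rightarrow> bool" where
  "complete_between E s A \<longleftrightarrow>
    (\<forall>i<s. \<forall>j<s. i \<noteq> j \<longrightarrow> (\<forall>x\<in>A i. \<forall>y\<in>A j. {x, y} \<in> E))"

lemma disjoint_blocks:
  assumes "finite A" "card A = m * r"
  obtains B where "\<And>j. j < m \<Longrightarrow> B j \<subseteq> A" "\<And>j. j < m \<Longrightarrow> card (B j) = r"
    "disjoint_family_on B {..<m}"
  using assms
proof (induction m arbitrary: A thesis)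
  case 0
  then show ?case by (auto simp: disjoint_family_on_def)
next
  case (Suc m)
  obtain C where C: "C \<subseteq> A" "card C = r"
    using Suc.prems(3) by (metis le_add1 mult_Suc obtain_subset_with_card_n)
  have "card (A - C) = m * r" "finite (A - C)"
    using C Suc.prems by (auto simp: card_Diff_subset finite_subset)
  then obtain B where B: "\<And>j. j < m \<Longrightarrow> B j \<subseteq> A - C" "\<And>j. j < m \<Longrightarrow> card (B j) = r"
    "disjoint_family_on B {..<m}"
    using Suc.IH by metis
  show ?case
  proof (rule Suc.prems(1)[of "B(m := C)"])
    show "disjoint_family_on (B(m := C)) {..<Suc m}"
      using B(1,3) unfolding disjoint_family_on_def
      by (auto simp: less_Suc_eq) blast+
  qed (use B C in \<open>auto simp: less_Suc_eq\<close>)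
qed

text \<open>
  The averaging over \<open>r\<close>-subsets of \<open>A\<close> runs over \<open>m\<close> disjoint blocks. A vertex with fewer than
  \<open>t\<close> neighbours in \<open>A\<close> is a common non-neighbour of at least \<open>m - t\<close> blocks, and each
  block has at most \<open>d\<close> common non-neighbours; the claim is the double count of these incidences.
\<close>

lemma card_few_neighbours_le:
  assumes free: "clique_book_free p r d V E"
    and A: "A \<subseteq> V" "indep A E" "card A = m * r"
  shows "card {v \<in> V. card {x \<in> A. {v, x} \<in> E} < t} * (m - t) \<le> m * d"
proof -
  define W where "W = {v \<in> V. card {x \<in> A. {v, x} \<in> E} < t}"
  have fin: "finite V" "finite A" "finite W"
    using free A(1) by (auto simp: clique_book_free_def W_def finite_subset)
  obtain B where B: "\<And>j. j < m \<Longrightarrow> B j \<subseteq> A" "\<And>j. j < m \<Longrightarrow> card (B j) = r"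
    "disjoint_family_on B {..<m}"
    using disjoint_blocks[OF fin(2) A(3)] by metis
  define miss where "miss v j \<longleftrightarrow> (\<forall>x\<in>B j. {v, x} \<notin> E)" for v j
  have many: "m - t \<le> card {j \<in> {..<m}. miss v j}" if "v \<in> W" for v
  proof -
    define J where "J = {j \<in> {..<m}. \<not> miss v j}"
    have "\<forall>j\<in>J. \<exists>x\<in>B j. {v, x} \<in> E" by (auto simp: J_def miss_def)
    then obtain h where h: "\<And>j. j \<in> J \<Longrightarrow> h j \<in> B j \<and> {v, h j} \<in> E" by metis
    have "inj_on h J"
    proof (rule inj_onI)
      fix i j assume ij: "i \<in> J" "j \<in> J" "h i = h j"
      then have "B i \<inter> B j \<noteq> {}" using h by fastforce
      then show "i = j"
        using B(3) ij by (auto simp: disjoint_family_on_def J_def)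
    qed
    moreover have "h ` J \<subseteq> {x \<in> A. {v, x} \<in> E}"
      using h B(1) by (fastforce simp: J_def)
    ultimately have "card J \<le> card {x \<in> A. {v, x} \<in> E}"
      using fin(2) by (intro card_inj_on_le) auto
    then have "card J < t" using that by (simp add: W_def)
    moreover have "card {j \<in> {..<m}. miss v j} + card J = card {..<m}"
    proof -
      have "{..<m} = {j \<in> {..<m}. miss v j} \<union> J" by (auto simp: J_def)
      then show ?thesis by (metis (no_types, lifting) J_def card_Un_disjoint disjoint_iff
            finite_Un finite_lessThan mem_Collect_eq)
    qed
    ultimately show ?thesis by simp
  qed
  have "card W * (m - t) \<le> (\<Sum>v\<in>W. card {j \<in> {..<m}. miss v j})"
    using sum_bounded_below[of W "m - t" "\<lambda>v. card {j \<in> {..<m}. miss v j}"] many by simp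
  also have "\<dots> = (\<Sum>j<m. card {v \<in> W. miss v j})"
    using fin by (intro sum_multicount_gen) auto
  also have "\<dots> \<le> (\<Sum>j<m. d)"
  proof (rule sum_mono)
    fix j assume j: "j \<in> {..<m}"
    have "{v \<in> W. miss v j} \<subseteq> common_nonneighbours E V (B j)"
      by (auto simp: W_def miss_def common_nonneighbours_def)
    then have "card {v \<in> W. miss v j} \<le> card (common_nonneighbours E V (B j))"
      using fin by (intro card_mono) (auto simp: common_nonneighbours_def)
    also have "\<dots> \<le> d"
      using free B(1,2)[of j] j A smaller_indep[OF A(2)]
      by (auto simp: clique_book_free_def)
    finally show "card {v \<in> W. miss v j} \<le> d" .
  qed
  finally show ?thesis by (simp add: W_def)
qed

section \<open>Building a complete multipartite subgraph with independent parts\<close>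

lemma ramsey_clique_book_free:
  obtains N where "\<And>r d (V :: 'a set) E A. clique_book_free p r d V E \<Longrightarrow> A \<subseteq> V \<Longrightarrow> card A = N \<Longrightarrow>
    \<exists>R\<subseteq>A. card R = n \<and> indep R E"
proof -
  obtain N where N: "\<And>(V :: 'a set) E. finite V \<Longrightarrow> card V \<ge> N \<Longrightarrow>
    \<exists>R\<subseteq>V. card R = Suc p \<and> clique R E \<or> card R = n \<and> indep R E"
    using ramsey2[of "Suc p" n] by metis
  show ?thesis
  proof
    fix r d and V :: "'a set" and E A
    assume *: "clique_book_free p r d V E" "A \<subseteq> V" "card A = N"
    then have "finite A" by (auto simp: clique_book_free_def finite_subset)
    then obtain R where "R \<subseteq> A" "card R = Suc p \<and> clique R E \<or> card R = n \<and> indep R E"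
      using N[of A E] *(3) by auto
    moreover from this have "\<not> (card R = Suc p \<and> clique R E)"
      using *(1,2) unfolding clique_book_free_def
      by (metis Suc_n_not_le_n order_trans)
    ultimately show "\<exists>R\<subseteq>A. card R = n \<and> indep R E" by blast
  qed
qed

text \<open>
  The size \<open>T\<close> makes \<open>2 * p * t\<close> blocks of size \<open>r\<close> in each part. This is enough for the vertices that
  are poor in a given part to number at most \<open>2 * p * d / (2 * p - 1)\<close>; for \<open>p - 1\<close> parts this adds
  up to at most \<open>(p - 1/2) * d\<close>. The new part need not be independent: independence is restored
  afterwards by Ramsey's theorem, at the cost of a larger \<open>t\<close>.
\<close>

lemma add_part:
  assumes free: "clique_book_free p r d V E" and large: "p * d < card V"
    and s: "s < p" and t: "t > 0" and d: "2 * (t * 2 ^ (s * T)) \<le> d"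
    and T: "T = 2 * p * t * r"
    and A: "complete_between E s A"
      "\<And>i. i < s \<Longrightarrow> A i \<subseteq> V" "\<And>i. i < s \<Longrightarrow> card (A i) = T" "\<And>i. i < s \<Longrightarrow> indep (A i) E"
  obtains B where "complete_between E (Suc s) B"
    "\<And>i. i < Suc s \<Longrightarrow> B i \<subseteq> V" "\<And>i. i < Suc s \<Longrightarrow> card (B i) = t"
proof -
  have finV: "finite V" using free by (simp add: clique_book_free_def)
  define poor where "poor i = {v \<in> V. card {x \<in> A i. {v, x} \<in> E} < t}" for i
  define rich where "rich = V - (\<Union>i<s. poor i)"
  define U where "U = (\<Union>i<s. A i)"
  have poor: "card (poor i) * (2 * p - 1) \<le> 2 * p * d" if "i < s" for i
  proof -
    have "card (poor i) * (2 * p * t - t) \<le> 2 * p * t * d"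
      unfolding poor_def using A that T
      by (intro card_few_neighbours_le[OF free]) auto
    then have "t * (card (poor i) * (2 * p - 1)) \<le> t * (2 * p * d)"
      by (simp add: algebra_simps diff_mult_distrib2)
    then show ?thesis using t by simp
  qed
  have "card (\<Union>i<s. poor i) * (2 * p - 1) \<le> (\<Sum>i<s. card (poor i)) * (2 * p - 1)"
    by (intro mult_right_mono card_UN_le) auto
  also have "\<dots> \<le> (\<Sum>i<s. 2 * p * d)"
    unfolding sum_distrib_right by (intro sum_mono poor) auto
  also have "\<dots> \<le> (p - 1) * (2 * p * d)"
    using s by (simp only: sum_constant card_lessThan) (intro mult_right_mono, auto)
  finally have all_poor: "card (\<Union>i<s. poor i) * (2 * p - 1) \<le> (p - 1) * (2 * p * d)" .
  have "card V = card rich + card (\<Union>i<s. poor i)"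
  proof -
    have "(\<Union>i<s. poor i) \<subseteq> V" by (auto simp: poor_def)
    then show ?thesis
      using finV by (simp add: rich_def card_Diff_subset finite_subset card_mono)
  qed
  then have "p * d * (2 * p - 1) \<le> card rich * (2 * p - 1) + (p - 1) * (2 * p * d)"
    using all_poor large
    by (smt (verit) add_left_mono add_mult_distrib le_trans less_imp_le_nat mult_le_mono1)
  moreover have "p * d * (2 * p - 1) = p * d + (p - 1) * (2 * p * d)"
    using s by (cases p) (auto simp: algebra_simps)
  ultimately have "p * d \<le> card rich * (2 * p - 1)" by simp
  also have "\<dots> \<le> p * (2 * card rich)" by (simp add: algebra_simps diff_mult_distrib2)
  finally have "d \<le> 2 * card rich" using s by simp
  then have rich_large: "t * 2 ^ (s * T) \<le> card rich" using d by simp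
  have finU: "finite U"
    using A(2) finV by (auto simp: U_def intro: finite_subset)
  have cardU: "card U \<le> s * T"
  proof -
    have "card U \<le> (\<Sum>i<s. card (A i))" unfolding U_def by (intro card_UN_le) auto
    also have "\<dots> = s * T" using A(3) by simp
    finally show ?thesis .
  qed
  define trace where "trace v = {x \<in> U. {v, x} \<in> E}" for v
  obtain X where X: "card rich \<le> card (trace -` {X} \<inter> rich) * card (Pow U)"
    using pigeonhole_card[of trace rich "Pow U"] finV finU
    by (auto simp: trace_def rich_def)
  have "t * 2 ^ (s * T) \<le> card (trace -` {X} \<inter> rich) * 2 ^ card U"
    using X rich_large finU by (simp add: card_Pow)
  also have "\<dots> \<le> card (trace -` {X} \<inter> rich) * 2 ^ (s * T)"
    using cardU by (intro mult_left_mono power_increasing) auto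
  finally have "t \<le> card (trace -` {X} \<inter> rich)" by simp
  then obtain F where F: "F \<subseteq> trace -` {X} \<inter> rich" "card F = t"
    using obtain_subset_with_card_n by metis
  \<comment> \<open>The vertices of \<open>F\<close> are rich and have the same trace \<open>X\<close>, so \<open>X\<close> meets every old part in at
    least \<open>t\<close> vertices.\<close>
  have "\<exists>C\<subseteq>A i \<inter> X. card C = t" if i: "i < s" for i
  proof -
    obtain v where v: "v \<in> F" using F(2) t by (cases "F = {}") auto
    then have "v \<in> V" "v \<notin> poor i" using F(1) i by (auto simp: rich_def)
    then have "t \<le> card {x \<in> A i. {v, x} \<in> E}" by (auto simp: poor_def)
    also have "{x \<in> A i. {v, x} \<in> E} = A i \<inter> X"
    proof -
      have "trace v = X" using v F(1) by auto
      then show ?thesis using i by (auto simp: trace_def U_def)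
    qed
    finally show ?thesis using obtain_subset_with_card_n by metis
  qed
  then obtain C where C: "\<And>i. i < s \<Longrightarrow> C i \<subseteq> A i \<inter> X \<and> card (C i) = t" by metis
  have FX: "{v, x} \<in> E" if "v \<in> F" "x \<in> X" for v x
    using that F(1) by (auto simp: trace_def)
  show ?thesis
  proof
    show "complete_between E (Suc s) (C(s := F))"
      unfolding complete_between_def
    proof (intro allI impI ballI)
      fix i j x y
      assume "i < Suc s" "j < Suc s" "i \<noteq> j" "x \<in> (C(s := F)) i" "y \<in> (C(s := F)) j"
      then consider "i < s" "j < s" "i \<noteq> j" "x \<in> C i" "y \<in> C j"
        | "i < s" "x \<in> C i" "y \<in> F" | "j < s" "x \<in> F" "y \<in> C j"
        by (auto split: if_splits)
      then show "{x, y} \<in> E"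
      proof cases
        case 1
        then show ?thesis using A(1) C unfolding complete_between_def by blast
      next
        case 2
        then show ?thesis using FX[of y x] C[of i] by (auto simp: insert_commute)
      next
        case 3
        then show ?thesis using FX[of x y] C[of j] by auto
      qed
    qed
    show "(C(s := F)) i \<subseteq> V" if "i < Suc s" for i
      using that C[of i] A(2)[of i] F(1) by (cases "i = s") (auto simp: rich_def)
    show "card ((C(s := F)) i) = t" if "i < Suc s" for i
      using that C[of i] F(2) by auto
  qed
qed

lemma complete_multipartite_exists:
  assumes "s \<le> p"
  shows "\<exists>d\<^sub>0. \<forall>d\<ge>d\<^sub>0. \<forall>(V :: 'a set) E. clique_book_free p r d V E \<and> p * d < card V \<longrightarrow>
    (\<exists>A. complete_between E s A \<and> (\<forall>i<s. A i \<subseteq> V \<and> card (A i) = t \<and> indep (A i) E))"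
  using assms
proof (induction s arbitrary: t)
  case 0
  then show ?case by (auto simp: complete_between_def)
next
  case (Suc s)
  obtain N where N: "\<And>r d (V :: 'a set) E A. clique_book_free p r d V E \<Longrightarrow> A \<subseteq> V \<Longrightarrow>
      card A = N \<Longrightarrow> \<exists>R\<subseteq>A. card R = t \<and> indep R E"
    using ramsey_clique_book_free[of p t] by metis
  \<comment> \<open>Parts of size \<open>Suc N\<close> instead of \<open>N\<close>, since the part to be added must not be empty.\<close>
  define T where "T = 2 * p * Suc N * r"
  obtain d\<^sub>0 where d\<^sub>0: "\<And>d (V :: 'a set) E. d \<ge> d\<^sub>0 \<Longrightarrow> clique_book_free p r d V E \<Longrightarrow>
      p * d < card V \<Longrightarrow> \<exists>A. complete_between E s A \<and>
        (\<forall>i<s. A i \<subseteq> V \<and> card (A i) = T \<and> indep (A i) E)"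
    using Suc.IH[of T] Suc.prems Suc_leD by meson
  show ?case
  proof (intro exI[of _ "max d\<^sub>0 (2 * (Suc N * 2 ^ (s * T)))"] allI impI, elim conjE)
    fix d and V :: "'a set" and E
    assume d: "max d\<^sub>0 (2 * (Suc N * 2 ^ (s * T))) \<le> d"
      and free: "clique_book_free p r d V E" and large: "p * d < card V"
    obtain A where A: "complete_between E s A"
      "\<And>i. i < s \<Longrightarrow> A i \<subseteq> V \<and> card (A i) = T \<and> indep (A i) E"
      using d\<^sub>0[OF _ free large] d by auto
    obtain B where B: "complete_between E (Suc s) B"
      "\<And>i. i < Suc s \<Longrightarrow> B i \<subseteq> V" "\<And>i. i < Suc s \<Longrightarrow> card (B i) = Suc N"
      using add_part[OF free large _ _ _ T_def A(1)] A(2) d Suc.prems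
      by (metis Suc_le_lessD max.bounded_iff zero_less_Suc)
    have "\<exists>R\<subseteq>B i. card R = t \<and> indep R E" if i: "i < Suc s" for i
    proof -
      obtain B' where "B' \<subseteq> B i" "card B' = N"
        using B(3)[OF i] by (metis le_SucI obtain_subset_with_card_n order_refl)
      then show ?thesis using N[OF free, of B'] B(2)[OF i] by (meson order_trans)
    qed
    then obtain R where R: "\<And>i. i < Suc s \<Longrightarrow> R i \<subseteq> B i \<and> card (R i) = t \<and> indep (R i) E"
      by metis
    moreover have "complete_between E (Suc s) R"
      using B(1) R unfolding complete_between_def by (meson subsetD)
    ultimately show "\<exists>A. complete_between E (Suc s) A \<and>
        (\<forall>i<Suc s. A i \<subseteq> V \<and> card (A i) = t \<and> indep (A i) E)"
      using B(2) by (meson order_trans)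
  qed
qed

section \<open>The upper bound on the order\<close>

text \<open>Otherwise \<open>v\<close> and one neighbour of \<open>v\<close> from each part would be a clique of size \<open>p + 1\<close>.\<close>

lemma misses_a_part:
  assumes free: "clique_book_free p r d V E" and A: "complete_between E p A" "\<And>i. i < p \<Longrightarrow> A i \<subseteq> V"
    and v: "v \<in> V"
  shows "\<exists>i<p. v \<in> common_nonneighbours E V (A i)"
proof (rule ccontr)
  assume "\<not> ?thesis"
  then have "\<forall>i<p. \<exists>x\<in>A i. {v, x} \<in> E" using v by (auto simp: common_nonneighbours_def)
  then obtain x where x: "\<And>i. i < p \<Longrightarrow> x i \<in> A i \<and> {v, x i} \<in> E" by metis
  have irrefl: "{w} \<notin> E" for w using free by (simp add: clique_book_free_def)
  have xx: "{x i, x j} \<in> E" if "i < p" "j < p" "i \<noteq> j" for i j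
    using A(1) x that unfolding complete_between_def by blast
  have "inj_on x {..<p}"
    using xx irrefl by (intro inj_onI) (metis insert_absorb2 lessThan_iff)
  moreover have "v \<notin> x ` {..<p}" using x irrefl by fastforce
  ultimately have "card (insert v (x ` {..<p})) = Suc p" by (simp add: card_image)
  moreover have "clique (insert v (x ` {..<p})) E"
    using x xx by (fastforce simp: clique_def insert_commute)
  moreover have "insert v (x ` {..<p}) \<subseteq> V" using v x A(2) by blast
  ultimately show False using free unfolding clique_book_free_def by (metis Suc_n_not_le_n)
qed

lemma clique_book_free_card_le:
  "\<exists>d\<^sub>0. \<forall>d\<ge>d\<^sub>0. \<forall>(V :: 'a set) E. clique_book_free p r d V E \<longrightarrow> card V \<le> p * d"
proof -
  obtain d\<^sub>0 where d\<^sub>0: "\<And>d (V :: 'a set) E. d \<ge> d\<^sub>0 \<Longrightarrow> clique_book_free p r d V E \<Longrightarrow>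
      p * d < card V \<Longrightarrow> \<exists>A. complete_between E p A \<and>
        (\<forall>i<p. A i \<subseteq> V \<and> card (A i) = r \<and> indep (A i) E)"
    using complete_multipartite_exists[OF order_refl, of p r r] by meson
  have "card V \<le> p * d" if "d \<ge> d\<^sub>0" and free: "clique_book_free p r d V E" for d and V :: "'a set" and E
  proof (rule ccontr)
    assume "\<not> card V \<le> p * d"
    then obtain A where A: "complete_between E p A"
        "\<And>i. i < p \<Longrightarrow> A i \<subseteq> V \<and> card (A i) = r \<and> indep (A i) E"
      using d\<^sub>0[OF \<open>d \<ge> d\<^sub>0\<close> free] by (auto simp: not_le)
    have "finite V" using free by (simp add: clique_book_free_def)
    have "V \<subseteq> (\<Union>i<p. common_nonneighbours E V (A i))"
      using misses_a_part[OF free A(1)] A(2) by blast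
    then have "card V \<le> card (\<Union>i<p. common_nonneighbours E V (A i))"
      using \<open>finite V\<close> by (intro card_mono) (auto simp: common_nonneighbours_def)
    also have "\<dots> \<le> (\<Sum>i<p. card (common_nonneighbours E V (A i)))"
      by (intro card_UN_le) auto
    also have "\<dots> \<le> (\<Sum>i<p. d)"
      using free A(2) by (intro sum_mono) (auto simp: clique_book_free_def)
    finally show False using \<open>\<not> card V \<le> p * d\<close> by simp
  qed
  then show ?thesis by blast
qed

section \<open>Translation to copies of complete graphs and books\<close>

lemma pair_wf_complete_graph: "pair_wf_digraph (complete_graph n)"
  by unfold_locales (auto simp: complete_graph_def)

lemma clique_book_free_of_no_copies:
  assumes G: "pair_graph G"
    and no_clique: "\<not> contains_copy G (complete_graph (p + 1))"
    and no_book: "\<not> contains_copy (complement_graph G) (book_graph r q)"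
  shows "clique_book_free p r (q + r - 1) (pverts G) {{u, v} | u v. (u, v) \<in> parcs G}"
proof -
  interpret pair_graph G by fact
  interpret C: pair_graph "complement_graph G" by (rule pair_graph_complement[OF G])
  interpret B: pair_graph "book_graph r q" by (rule pair_graph_book)
  define E where "E = {{u, v} | u v. (u, v) \<in> parcs G}"
  have E: "{u, v} \<in> E \<longleftrightarrow> (u, v) \<in> parcs G" for u v
    using pair_sym_arcs unfolding E_def symmetric_def
    by (auto simp: doubleton_eq_iff dest: symD)
  have irrefl: "{v} \<notin> E" for v
    using E[of v v] pair_no_loops by (metis insert_absorb2 prod.sel)
  have "card K \<le> p" if K: "K \<subseteq> pverts G" "clique K E" for K
  proof (rule ccontr)
    assume "\<not> card K \<le> p"
    then obtain K' where K': "K' \<subseteq> K" "card K' = p + 1"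
      by (metis Suc_eq_plus1 not_less_eq_eq obtain_subset_with_card_n)
    then have "finite K'" by (intro card_ge_0_finite) simp
    then obtain f where f: "bij_betw f {..<p + 1} K'"
      using K'(2) by (metis bij_betw_iff_card card_lessThan finite_lessThan)
    have "contains_copy G (complete_graph (p + 1))"
      unfolding contains_copy_iff[OF pair_wf_digraph_axioms pair_wf_complete_graph]
    proof (intro exI conjI allI impI)
      show "inj_on f (pverts (complete_graph (p + 1)))"
        using f by (simp add: complete_graph_def bij_betw_def)
      show "f ` pverts (complete_graph (p + 1)) \<subseteq> pverts G"
        using f K K' by (auto simp: complete_graph_def bij_betw_def)
      fix u v assume uv: "(u, v) \<in> parcs (complete_graph (p + 1))"
      then have "f u \<in> K" "f v \<in> K" "f u \<noteq> f v"
        using f K' by (auto simp: complete_graph_def bij_betw_def inj_on_def)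
      then show "(f u, f v) \<in> parcs G" using K(2) E by (auto simp: clique_def)
    qed
    then show False using no_clique by simp
  qed
  moreover have "card (common_nonneighbours E (pverts G) S) \<le> q + r - 1"
    if S: "S \<subseteq> pverts G" "indep S E" "card S = r" for S
  proof (rule ccontr)
    let ?W = "common_nonneighbours E (pverts G) S"
    assume "\<not> card ?W \<le> q + r - 1"
    then have "q + r \<le> card ?W" by simp
    moreover have finS: "finite S" using S(1) by (rule finite_subset) simp
    moreover have "S \<subseteq> ?W"
      using S irrefl unfolding common_nonneighbours_def indep_def
      by auto (metis insert_absorb2)
    ultimately have "q \<le> card (?W - S)" using S(3) by (simp add: card_Diff_subset)
    then obtain L where L: "L \<subseteq> ?W - S" "card L = q"
      using obtain_subset_with_card_n by metis
    have "finite L" by (rule finite_subset[OF _ pair_finite_verts])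
        (use L in \<open>auto simp: common_nonneighbours_def\<close>)
    obtain g where g: "bij_betw g {..<r} S"
      using finS S(3) by (metis bij_betw_iff_card card_lessThan finite_lessThan)
    have "card {r..<r + q} = card L" using L by simp
    then obtain h where h: "bij_betw h {r..<r + q} L"
      using \<open>finite L\<close> by (metis bij_betw_iff_card finite_atLeastLessThan)
    define f where "f i = (if i < r then g i else h i)" for i
    have fS: "f i \<in> S" if "i < r" for i
      using g that by (auto simp: f_def bij_betw_def)
    have fL: "f i \<in> L" if "i < r + q" "\<not> i < r" for i
      using h that by (auto simp: f_def bij_betw_def)
    have inj: "inj_on f {..<r + q}"
    proof (rule inj_onI)
      fix i j assume ij: "i \<in> {..<r + q}" "j \<in> {..<r + q}" "f i = f j"
      show "i = j"
      proof (cases "i < r \<longleftrightarrow> j < r")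
        case True
        then show ?thesis using ij g h
          by (auto simp: f_def bij_betw_def inj_on_def split: if_splits)
      next
        case False
        then show ?thesis using ij fS[of i] fS[of j] fL[of i] fL[of j] L(1) by auto
      qed
    qed
    have "contains_copy (complement_graph G) (book_graph r q)"
      unfolding contains_copy_iff[OF C.pair_wf_digraph_axioms B.pair_wf_digraph_axioms]
    proof (intro exI conjI allI impI)
      show "inj_on f (pverts (book_graph r q))" using inj by (simp add: book_graph_def)
      have fW: "f i \<in> ?W" if "i < r + q" for i
        using fS[of i] fL[of i] that L(1) \<open>S \<subseteq> ?W\<close> by auto
      then show "f ` pverts (book_graph r q) \<subseteq> pverts (complement_graph G)"
        by (auto simp: book_graph_def complement_graph_def common_nonneighbours_def)
      fix u v assume "(u, v) \<in> parcs (book_graph r q)"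
      then have uv: "u < r + q" "v < r + q" "u \<noteq> v" "u < r \<or> v < r"
        by (auto simp: book_graph_def)
      then have "f u \<in> ?W" "f v \<in> ?W" "f u \<noteq> f v" "f u \<in> S \<or> f v \<in> S"
        using fW fS inj by (auto simp: inj_on_def)
      moreover from this have "{f u, f v} \<notin> E"
        by (auto simp: common_nonneighbours_def insert_commute)
      ultimately show "(f u, f v) \<in> parcs (complement_graph G)"
        using E by (auto simp: complement_graph_def common_nonneighbours_def)
    qed
    then show False using no_book by simp
  qed
  ultimately show ?thesis
    unfolding E_def[symmetric] clique_book_free_def using irrefl by simp
qed

section \<open>The extremal graph\<close>

text \<open>
  The complete multipartite graph whose parts are the consecutive intervals of length \<open>d\<close> in
  \<open>{..<m}\<close>. The order \<open>m\<close> is arbitrary because leastness of the Ramsey number requires a graph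
  without the two copies for every order up to \<open>p * d\<close>.
\<close>

definition blocks_graph :: "nat \<Rightarrow> nat \<Rightarrow> nat pair_pre_digraph" where
  "blocks_graph d m =
    \<lparr> pverts = {..<m}, parcs = {(u, v). u < m \<and> v < m \<and> u div d \<noteq> v div d} \<rparr>"

lemma pair_graph_blocks: "pair_graph (blocks_graph d m)"
proof -
  have "finite (parcs (blocks_graph d m))"
    by (rule finite_subset[of _ "{..<m} \<times> {..<m}"]) (auto simp: blocks_graph_def)
  then show ?thesis
    by unfold_locales (auto simp: blocks_graph_def symmetric_def intro!: symI)
qed

lemma blocks_graph_no_clique:
  assumes "m \<le> p * d"
  shows "\<not> contains_copy (blocks_graph d m) (complete_graph (p + 1))"
proof
  interpret pair_graph "blocks_graph d m" by (rule pair_graph_blocks)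
  assume "contains_copy (blocks_graph d m) (complete_graph (p + 1))"
  then obtain f where f: "f ` pverts (complete_graph (p + 1)) \<subseteq> pverts (blocks_graph d m)"
    "\<And>u v. (u, v) \<in> parcs (complete_graph (p + 1)) \<Longrightarrow> (f u, f v) \<in> parcs (blocks_graph d m)"
    unfolding contains_copy_iff[OF pair_wf_digraph_axioms pair_wf_complete_graph] by metis
  have "inj_on (\<lambda>u. f u div d) {..<p + 1}"
    using f(2) by (intro inj_onI) (force simp: complete_graph_def blocks_graph_def)
  moreover have "(\<lambda>u. f u div d) ` {..<p + 1} \<subseteq> {..<p}"
  proof (intro image_subsetI)
    fix u assume "u \<in> {..<p + 1}"
    then have "f u < p * d" using f(1) assms by (auto simp: complete_graph_def blocks_graph_def)
    then show "f u div d \<in> {..<p}" by (simp add: less_mult_imp_div_less)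
  qed
  ultimately have "card {..<p + 1} \<le> card {..<p}" by (intro card_inj_on_le) auto
  then show False by simp
qed

text \<open>
  Vertex \<open>0\<close> belongs to the spine, so it is adjacent to every other vertex of the book; a copy in the
  complement therefore lies within a single part.
\<close>

lemma blocks_graph_no_book:
  assumes "r > 0" "d > 0" "d < q + r"
  shows "\<not> contains_copy (complement_graph (blocks_graph d m)) (book_graph r q)"
proof
  interpret C: pair_graph "complement_graph (blocks_graph d m)"
    by (rule pair_graph_complement[OF pair_graph_blocks])
  interpret B: pair_graph "book_graph r q" by (rule pair_graph_book)
  assume "contains_copy (complement_graph (blocks_graph d m)) (book_graph r q)"
  then obtain f where f: "inj_on f {..<r + q}"
    "\<And>u v. (u, v) \<in> parcs (book_graph r q) \<Longrightarrow>
      (f u, f v) \<in> parcs (complement_graph (blocks_graph d m))"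
    unfolding contains_copy_iff[OF C.pair_wf_digraph_axioms B.pair_wf_digraph_axioms]
    by (auto simp: book_graph_def)
  define b where "b = f 0 div d"
  have "f ` {..<r + q} \<subseteq> {b * d..<b * d + d}"
  proof (intro image_subsetI)
    fix u assume u: "u \<in> {..<r + q}"
    have "f u div d = b"
    proof (cases "u = 0")
      case False
      then show ?thesis using f(2)[of 0 u] u assms(1)
        by (auto simp: b_def book_graph_def blocks_graph_def complement_graph_def)
    qed (simp add: b_def)
    then show "f u \<in> {b * d..<b * d + d}"
      using assms(2) div_mult_mod_eq[of "f u" d] mod_less_divisor[of d "f u"]
      by (simp, linarith)
  qed
  then have "card {..<r + q} \<le> card {b * d..<b * d + d}"
    using f(1) by (intro card_inj_on_le) auto
  then show False using assms(3) by simp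
qed

theorem theorem8:
  fixes p r :: nat
  assumes "p \<ge> 2" and "r \<ge> 2"
  shows "\<exists>q\<^sub>0. \<forall>q\<ge>q\<^sub>0.
    ramsey_number (complete_graph (p + 1)) (book_graph r q) = p * (q + r - 1) + 1"
proof -
  obtain d\<^sub>0 where d\<^sub>0: "\<And>d (V :: nat set) E. d \<ge> d\<^sub>0 \<Longrightarrow> clique_book_free p r d V E \<Longrightarrow>
      card V \<le> p * d"
    using clique_book_free_card_le[of p r] by metis
  have "ramsey_number (complete_graph (p + 1)) (book_graph r q) = p * (q + r - 1) + 1"
    if "q \<ge> d\<^sub>0" for q
    unfolding ramsey_number_def
  proof (rule Least_equality)
    show "\<forall>G :: nat pair_pre_digraph. pair_graph G \<and> card (pverts G) = p * (q + r - 1) + 1 \<longrightarrow>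
        contains_copy G (complete_graph (p + 1)) \<or>
        contains_copy (complement_graph G) (book_graph r q)"
    proof (intro allI impI, elim conjE, rule ccontr)
      fix G :: "nat pair_pre_digraph"
      assume G: "pair_graph G" "card (pverts G) = p * (q + r - 1) + 1"
        and "\<not> (contains_copy G (complete_graph (p + 1)) \<or>
          contains_copy (complement_graph G) (book_graph r q))"
      then have "card (pverts G) \<le> p * (q + r - 1)"
        using that assms(2) by (intro d\<^sub>0[OF _ clique_book_free_of_no_copies]) auto
      then show False using G(2) by simp
    qed
  next
    fix m
    assume m: "\<forall>G :: nat pair_pre_digraph. pair_graph G \<and> card (pverts G) = m \<longrightarrow>
        contains_copy G (complete_graph (p + 1)) \<or>
        contains_copy (complement_graph G) (book_graph r q)"
    show "p * (q + r - 1) + 1 \<le> m"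
    proof (rule ccontr)
      assume "\<not> ?thesis"
      then have "\<not> contains_copy (blocks_graph (q + r - 1) m) (complete_graph (p + 1))"
        by (intro blocks_graph_no_clique) simp
      moreover have "\<not> contains_copy (complement_graph (blocks_graph (q + r - 1) m)) (book_graph r q)"
        using assms(2) by (intro blocks_graph_no_book) auto
      moreover have "card (pverts (blocks_graph (q + r - 1) m)) = m"
        by (simp add: blocks_graph_def)
      ultimately show False using m pair_graph_blocks by blast
    qed
  qed
  then show ?thesis by blast
qed

end
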